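(* Let $\mathcal{D}$ be a normal and neutral domain, let $m_0=\min\{m\in\mathbb{N}:\mathrm{con}_{\mathcal{D}}(m)<1\}$, and suppose the number of alternatives is at least $m_0$. Then for every $\varepsilon_v$ with $0\le\varepsilon_v<\mathrm{res}_{\mathcal{D}}(m_0)$ and every $0<\delta<1/2$ there exists an $(\varepsilon_v,0,\delta,\mathcal{D})$-Arbitrary Outliers vs Random Profile Tester with sample complexity $$O\left(\frac{1}{\left(1-\varepsilon_v/\mathrm{res}_{\mathcal{D}}(m_0)\right)^2}\ln\frac{1}{\delta}\right),$$ where the $O(\cdot)$ notation hides a constant which depends on $m_0$.
   Context: Profiles and domains. Let $\mathcal{A}$ be a finite set of $m$ alternatives and $\mathcal{L}(\mathcal{A})$ the set of linear orders (preferences) over $\mathcal{A}$; for $\mathcal{X}\subseteq\mathcal{A}$, $\succ(\mathcal{X})$ is the restriction of $\succ$ to $\mathcal{X}$. A profile is a tuple $(\succ_i)_{i\in[n]}$ of $n$ preferences over $\mathcal{A}$, one per agent. A domain $\mathcal{D}$ is a collection of subsets of $\bigcup_{|\mathcal{A}|>0}\mathcal{L}(\mathcal{A})$; a profile $\mathcal{P}$ of $n$ preferences belongs to $\mathcal{D}$ (written $\mathcal{P}\in\mathcal{D}$) if there is $\mathcal{B}\in\mathcal{D}$ with $\mathcal{P}\in\mathcal{B}^n$. $\mathcal{D}$ is neutral if membership of profiles in $\mathcal{D}$ is preserved under renaming the alternatives by any permutation (the same for all preferences of the profile). $\mathcal{D}$ is normal if $(\succ_i)_{i\in[n]}\in\mathcal{D}$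 implies $(\succ_i(\mathcal{X}))_{i\in[n]}\in\mathcal{D}$ for every $\mathcal{X}\subseteq\mathcal{A}$. The content of $\mathcal{D}$ is the function $\mathrm{con}_{\mathcal{D}}:\mathbb{N}\to[0,1]$ such that $\mathrm{con}_{\mathcal{D}}(m)\,m!$ is the maximum number of distinct preferences in a profile over $m$ alternatives belonging to $\mathcal{D}$ (with $\mathrm{con}_{\mathcal{D}}(1)=1$); the residue is $\mathrm{res}_{\mathcal{D}}(m)=1-\mathrm{con}_{\mathcal{D}}(m)$. Sampling model. An oracle, when queried, returns an agent picked uniformly at random with replacement from the set of all $n$ agents. The algorithm may then ask this agent arbitrarily many comparison queries: given two alternatives $x,y$, the agent replies which of the two it prefers. The sample complexity of an algorithm is the total number of comparison queries it makes. Problem. An $(\varepsilon_v,0,\delta,\mathcal{D})$-Arbitrary Outliers vs Random Profile Tester is a (randomized) algorithm in this model which, given a profile $(\succ_i)_{i\in[n]}$ over $\mathcal{A}$ that is of one of the following two kinds, outputs $1$ if it is of kind (i) and $0$ if it is of kind (ii), with error probability at most $\delta$: (i) there exists $\mathcal{W}\subseteq[n]$ with $|\mathcal{W}|\ge(1-\varepsilon_v)n$ such that $(\succ_i)_{i\in\mathcal{W}}\in\mathcal{D}$; (ii) for every $i\in[n]$, $\succ_i$ is distributed (independently) uniformly in $\mathcal{L}(\mathcal{A})$. The error probability is over the randomness generating the instance in (ii) and the randomness of the algorithm (including the oracle).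
   Formalization: For random profiles (kind (ii)) the number n of agents must be at least K·ln(1/δ)/(1−ε_v/res(m_0))², with K depending only on m_0; without this the claim fails, e.g. for n=1, where a random profile can itself be of kind (i). *)

theory Defs
  imports
    "HOL-Probability.Probability"
    "HOL-Combinatorics.Permutations"
    "HOL-Library.Infinite_Typeclass"
begin

section \<open>Preferences, profiles and domains\<close>

text \<open>
  Alternatives come from an infinite type, so that there are alternative sets of every finite size.
  A preference is the reflexive linear order whose pairs \<open>(x, y)\<close> say that \<open>x\<close> is weakly
  preferred to \<open>y\<close>; for \<open>x \<noteq> y\<close> this is the strict preference of \<open>x\<close> over \<open>y\<close>.
\<close>

definition preferences :: "'a set \<Rightarrow> 'a rel set" where
  "preferences A = {r. linear_order_on A r}"

definition restrict_pref :: "'a set \<Rightarrow> 'a rel \<Rightarrow> 'a rel" where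
  "restrict_pref X r = r \<inter> X \<times> X"

definition rename_pref :: "('a \<Rightarrow> 'a) \<Rightarrow> 'a rel \<Rightarrow> 'a rel" where
  "rename_pref \<pi> r = map_prod \<pi> \<pi> ` r"

text \<open>
  A profile is a family of preferences indexed by a finite set of agents; values outside the
  index set are irrelevant.
\<close>

definition profile :: "nat set \<Rightarrow> 'a set \<Rightarrow> (nat \<Rightarrow> 'a rel) \<Rightarrow> bool" where
  "profile I A P \<longleftrightarrow> finite I \<and> (\<forall>i\<in>I. P i \<in> preferences A)"

definition is_domain :: "'a rel set set \<Rightarrow> bool" where
  "is_domain D \<longleftrightarrow> (\<forall>B\<in>D. B \<subseteq> (\<Union>A\<in>{A. finite A \<and> A \<noteq> {}}. preferences A))"

definition in_domain :: "nat set \<Rightarrow> (nat \<Rightarrow> 'a rel) \<Rightarrow> 'a rel set set \<Rightarrow> bool" where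
  "in_domain I P D \<longleftrightarrow> (\<exists>B\<in>D. \<forall>i\<in>I. P i \<in> B)"

definition neutral :: "'a rel set set \<Rightarrow> bool" where
  "neutral D \<longleftrightarrow> (\<forall>I A P \<pi>. finite A \<and> A \<noteq> {} \<and> profile I A P \<and> in_domain I P D \<and> \<pi> permutes A
      \<longrightarrow> in_domain I (\<lambda>i. rename_pref \<pi> (P i)) D)"

text \<open>
  Only nonempty \<open>X\<close> are considered, because domains contain no preferences over the empty set of
  alternatives.
\<close>

definition normal_domain :: "'a rel set set \<Rightarrow> bool" where
  "normal_domain D \<longleftrightarrow> (\<forall>I A P X. finite A \<and> A \<noteq> {} \<and> profile I A P \<and> in_domain I P D \<and> X \<subseteq> A \<and> X \<noteq> {}
      \<longrightarrow> in_domain I (\<lambda>i. restrict_pref X (P i)) D)"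

text \<open>
  The set below is bounded by \<open>m!\<close>, so its supremum is its maximum (and \<open>0\<close> if it is empty, which
  for \<open>m \<ge> 1\<close> only happens for the domain without any members).
\<close>

definition domain_content :: "'a rel set set \<Rightarrow> nat \<Rightarrow> real" where
  "domain_content D m = (if m = 1 then 1 else
     real (Sup {card (P ` I) | I A P. finite A \<and> card A = m \<and> profile I A P \<and> in_domain I P D})
       / fact m)"

definition domain_residue :: "'a rel set set \<Rightarrow> nat \<Rightarrow> real" where
  "domain_residue D m = 1 - domain_content D m"

definition critical_size :: "'a rel set set \<Rightarrow> nat" where
  "critical_size D = (LEAST m. m \<ge> 1 \<and> domain_content D m < 1)"

section \<open>Sampling algorithms\<close>

text \<open>
  A deterministic adaptive algorithm either stops with an output or draws an agent from the
  oracle. It may then interview this agent by comparison queries, and finally dismisses the agent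
  and goes on. The algorithm learns nothing about a drawn agent beyond the answers to its queries;
  in particular it does not see the agent's index or the number of agents.
\<close>

datatype 'a strategy = Output bool | Draw "'a interview"
and 'a interview = Compare 'a 'a "bool \<Rightarrow> 'a interview" | Dismiss "'a strategy"

text \<open>\<open>Q\<close> is the distribution of the preference of an agent returned by the oracle.\<close>

primrec run :: "'a rel pmf \<Rightarrow> 'a strategy \<Rightarrow> bool pmf"
  and run_interview :: "'a rel pmf \<Rightarrow> 'a interview \<Rightarrow> 'a rel \<Rightarrow> bool pmf" where
  "run Q (Output b) = return_pmf b"
| "run Q (Draw v) = bind_pmf Q (run_interview Q v)"
| "run_interview Q (Compare x y k) = (\<lambda>r. run_interview Q (k ((x, y) \<in> r)) r)"
| "run_interview Q (Dismiss s) = (\<lambda>r. run Q s)"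

text \<open>Number of comparison queries in the worst case over all sequences of answers.\<close>

primrec queries :: "'a strategy \<Rightarrow> nat"
  and queries_interview :: "'a interview \<Rightarrow> nat" where
  "queries (Output b) = 0"
| "queries (Draw v) = queries_interview v"
| "queries_interview (Compare x y k) =
     Suc (max (queries_interview (k True)) (queries_interview (k False)))"
| "queries_interview (Dismiss s) = queries s"

text \<open>
  A randomized algorithm is a distribution over deterministic ones. The oracle picks agents
  uniformly with replacement from \<open>{..<n}\<close>.
\<close>

definition execute :: "'a strategy pmf \<Rightarrow> nat \<Rightarrow> (nat \<Rightarrow> 'a rel) \<Rightarrow> bool pmf" where
  "execute T n P = bind_pmf T (run (map_pmf P (pmf_of_set {..<n})))"

definition uniform_profile :: "nat \<Rightarrow> 'a set \<Rightarrow> (nat \<Rightarrow> 'a rel) pmf" where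
  "uniform_profile n A = Pi_pmf {..<n} {} (\<lambda>_. pmf_of_set (preferences A))"

definition sample_complexity_le :: "'a strategy pmf \<Rightarrow> real \<Rightarrow> bool" where
  "sample_complexity_le T q \<longleftrightarrow> (\<forall>t\<in>set_pmf T. real (queries t) \<le> q)"

definition few_outliers :: "real \<Rightarrow> 'a rel set set \<Rightarrow> nat \<Rightarrow> (nat \<Rightarrow> 'a rel) \<Rightarrow> bool" where
  "few_outliers \<epsilon> D n P \<longleftrightarrow>
     (\<exists>W \<subseteq> {..<n}. real (card W) \<ge> (1 - \<epsilon>) * real n \<and> in_domain W P D)"

text \<open>
  An \<open>(\<epsilon>, 0, \<delta>, D)\<close>-Arbitrary Outliers vs Random Profile Tester for profiles over \<open>A\<close>, where the
  random profiles are required to have at least \<open>n\<^sub>0\<close> agents; there is no such restriction on the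
  profiles with few outliers. A restriction is unavoidable: a random profile may itself belong to
  the domain, and for few agents this happens too often. If, for instance, the domain contains all
  one-agent profiles over \<open>A\<close>, then an algorithm that errs with probability at most \<open>\<delta> < 1/2\<close> on
  each of them outputs \<open>1\<close> with probability at least \<open>1 - \<delta> > \<delta>\<close> on a random one-agent profile.
\<close>

definition outliers_vs_random_tester ::
  "real \<Rightarrow> real \<Rightarrow> real \<Rightarrow> 'a rel set set \<Rightarrow> 'a set \<Rightarrow> 'a strategy pmf \<Rightarrow> bool" where
  "outliers_vs_random_tester n\<^sub>0 \<epsilon> \<delta> D A T \<longleftrightarrow>
     (\<forall>t\<in>set_pmf T. set_strategy t \<subseteq> A) \<and>
     (\<forall>n P. n \<ge> 1 \<and> profile {..<n} A P \<and> few_outliers \<epsilon> D n P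
        \<longrightarrow> measure_pmf.prob (execute T n P) {False} \<le> \<delta>) \<and>
     (\<forall>n. n \<ge> 1 \<and> real n \<ge> n\<^sub>0
        \<longrightarrow> measure_pmf.prob (bind_pmf (uniform_profile n A) (execute T n)) {True} \<le> \<delta>)"

end

(*
  Fix m0 alternatives X and interview O(b) agents completely about X. By normality, the answers of
  the agents that are not outliers lie in a set of at most con(m0) m0! orders of X, which has
  frequency at least 1 - eps, whereas under a random profile every such set has expected frequency
  at most con(m0) = 1 - res(m0). There are only finitely many sets of orders of X, so Hoeffding's
  inequality and a union bound over them separate the two cases with a threshold half-way. As every
  set of the right size is tested rather than a fixed member of the domain, no random renaming of
  the alternatives is needed.
*)

theory Submission
  imports Defs
begin

section \<open>Preferences\<close>

lemma preferences_subset: "preferences A \<subseteq> Pow (A \<times> A)"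
  by (auto simp: preferences_def order_on_defs)

lemma preferences_iff:
  "r \<in> preferences A \<longleftrightarrow> r \<subseteq> A \<times> A \<and> refl_on A r \<and> trans r \<and> antisym r \<and> total_on A r"
  by (auto simp only: preferences_def order_on_defs mem_Collect_eq)

lemma finite_preferences: "finite A \<Longrightarrow> finite (preferences A)"
  by (rule finite_subset[OF preferences_subset]) simp

lemma preferences_nonempty: "preferences A \<noteq> {}"
  using well_order_on[of A] by (auto simp: preferences_def well_order_on_def)

lemma card_preferences_le:
  assumes "finite A"
  shows "card (preferences A) \<le> 2 ^ (card A * card A)"
proof -
  have "card (preferences A) \<le> card (Pow (A \<times> A))"
    by (intro card_mono preferences_subset) (use assms in auto)
  then show ?thesis
    using assms by (simp add: card_Pow card_cartesian_product)
qed

lemma restrict_pref_in_preferences: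
  assumes "r \<in> preferences A" "X \<subseteq> A"
  shows "restrict_pref X r \<in> preferences X"
proof -
  have r: "r \<subseteq> A \<times> A" "refl_on A r" "trans r" "antisym r" "total_on A r"
    using assms(1) by (simp_all add: preferences_iff)
  have "trans (r \<inter> X \<times> X)"
    by (rule transI) (auto dest: transD[OF r(3)])
  moreover have "antisym (r \<inter> X \<times> X)"
    by (rule antisymI) (auto dest: antisymD[OF r(4)])
  ultimately show ?thesis
    using r(2,5) assms(2)
    by (simp add: preferences_iff restrict_pref_def refl_on_def total_on_def subset_iff)
qed

section \<open>Permutations of the alternatives acting on preferences\<close>

lemma mem_rename_pref_iff:
  assumes "inj \<pi>"
  shows "(\<pi> x, \<pi> y) \<in> rename_pref \<pi> r \<longleftrightarrow> (x, y) \<in> r"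
  using assms by (auto simp: rename_pref_def inj_eq)

lemma inj_rename_pref: "inj \<pi> \<Longrightarrow> inj (rename_pref \<pi>)"
  unfolding rename_pref_def using prod.inj_map[of \<pi> \<pi>] by (auto simp: inj_on_def inj_image_eq_iff)

lemma rename_pref_in_preferences:
  assumes "r \<in> preferences A" "\<pi> permutes A"
  shows "rename_pref \<pi> r \<in> preferences A"
proof -
  have r: "r \<subseteq> A \<times> A" "refl_on A r" "trans r" "antisym r" "total_on A r"
    using assms(1) by (simp_all add: preferences_iff)
  have inj: "inj \<pi>" and surj: "surj \<pi>"
    using assms(2) by (auto simp: permutes_inj permutes_surj)
  let ?q = "inv \<pi>"
  have mem: "(x, y) \<in> rename_pref \<pi> r \<longleftrightarrow> (?q x, ?q y) \<in> r" for x y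
    using mem_rename_pref_iff[OF inj, of "?q x" "?q y" r] by (simp add: surj_f_inv_f[OF surj])
  have q: "?q permutes A"
    by (rule permutes_inv[OF assms(2)])
  have qA: "?q x \<in> A \<longleftrightarrow> x \<in> A" and qeq: "?q x = ?q y \<longleftrightarrow> x = y" for x y
    using permutes_in_image[OF q] permutes_inj[OF q] by (auto simp: inj_eq)
  have "rename_pref \<pi> r \<subseteq> A \<times> A"
  proof (rule subrelI)
    fix x y assume "(x, y) \<in> rename_pref \<pi> r"
    then have "(?q x, ?q y) \<in> A \<times> A"
      using r(1) by (auto simp: mem)
    then show "(x, y) \<in> A \<times> A"
      by (simp add: qA)
  qed
  moreover have "trans (rename_pref \<pi> r)"
    by (rule transI) (auto simp: mem dest: transD[OF r(3)])
  moreover have "antisym (rename_pref \<pi> r)"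
    by (rule antisymI) (auto simp: mem dest: antisymD[OF r(4)] simp: qeq)
  ultimately show ?thesis
    using r(2,5) by (simp add: preferences_iff refl_on_def total_on_def mem qA qeq)
qed

text \<open>\<open>\<pi>\<close> maps \<open>X\<close> onto itself, so it moves pairs inside
  \<open>X\<close> to pairs inside \<open>X\<close> and no others. Hence a permutation of
  \<open>X\<close> carries fibres of the restriction map to fibres.\<close>

lemma restrict_rename_pref:
  assumes "\<pi> permutes X"
  shows "restrict_pref X (rename_pref \<pi> r) = rename_pref \<pi> (restrict_pref X r)"
  using permutes_in_image[OF assms] by (auto simp: restrict_pref_def rename_pref_def)

text \<open>The number of elements preferred to \<open>x\<close> is transported by renaming and determines \<open>x\<close>.\<close>

lemma rename_pref_permutation_unique:
  assumes "finite X" "r \<in> preferences X" "\<pi> permutes X" "\<sigma> permutes X"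
    and eq: "rename_pref \<pi> r = rename_pref \<sigma> r"
  shows "\<pi> = \<sigma>"
proof
  fix x
  define rank where "rank r x = card {y. (y, x) \<in> r}" for r :: "'a rel" and x
  have r': "rename_pref \<pi> r \<in> preferences X" (is "?r \<in> _")
    by (rule rename_pref_in_preferences[OF assms(2,3)])
  have rank_rename: "rank (rename_pref \<rho> r) (\<rho> x) = rank r x" if "\<rho> permutes X" for \<rho>
  proof -
    have "inj \<rho>" and "surj \<rho>"
      using that by (auto simp: permutes_inj permutes_surj)
    then have "{y. (y, \<rho> x) \<in> rename_pref \<rho> r} = \<rho> ` {y. (y, x) \<in> r}"
      by (auto simp: mem_rename_pref_iff rename_pref_def inj_eq)
    then show ?thesis
      unfolding rank_def using \<open>inj \<rho>\<close> by (simp add: card_image inj_on_subset[OF _ subset_UNIV])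
  qed
  \<comment> \<open>By transitivity everything weakly preferred to \<open>y\<close> is weakly
    preferred to \<open>z\<close>, and \<open>z\<close> itself is counted only for
    \<open>z\<close>.\<close>
  have rank_less: "rank ?r y < rank ?r z" if "(y, z) \<in> ?r" "y \<noteq> z" for y z
    unfolding rank_def
  proof (rule psubset_card_mono)
    have r: "?r \<subseteq> X \<times> X" "refl_on X ?r" "trans ?r" "antisym ?r"
      using r' by (simp_all add: preferences_iff)
    show "finite {w. (w, z) \<in> ?r}"
      by (rule finite_subset[OF _ assms(1)]) (use r(1) in auto)
    show "{w. (w, y) \<in> ?r} \<subset> {w. (w, z) \<in> ?r}"
    proof
      show "{w. (w, y) \<in> ?r} \<subseteq> {w. (w, z) \<in> ?r}"
        using that(1) transD[OF r(3)] by blast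
      have "(z, z) \<in> ?r"
        using that(1) r(1,2) by (auto simp: refl_on_def)
      moreover have "(z, y) \<notin> ?r"
        using that antisymD[OF r(4)] by blast
      ultimately show "{w. (w, y) \<in> ?r} \<noteq> {w. (w, z) \<in> ?r}"
        by blast
    qed
  qed
  show "\<pi> x = \<sigma> x"
  proof (cases "x \<in> X")
    case True
    \<comment> \<open>Distinct elements of \<open>X\<close> are comparable by totality, hence differ
      in rank; so equal ranks force equality.\<close>
    have "rank ?r (\<pi> x) = rank ?r (\<sigma> x)"
      using rank_rename[OF assms(3)] rank_rename[OF assms(4)] eq by simp
    moreover have "\<pi> x \<in> X" "\<sigma> x \<in> X"
      using True assms(3,4) by (auto simp: permutes_in_image)
    ultimately show ?thesis
      using r' rank_less[of "\<pi> x" "\<sigma> x"] rank_less[of "\<sigma> x" "\<pi> x"]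
      unfolding preferences_iff total_on_def by fastforce
  next
    case False
    then show ?thesis
      using assms(3,4) by (simp add: permutes_not_in)
  qed
qed

section \<open>Counting preferences with a given restriction\<close>

text \<open>The permutations of \<open>X\<close> move a fibre of the restriction map to \<open>|X|!\<close> disjoint fibres.\<close>

lemma card_restrict_pref_fibre:
  assumes "finite A" "X \<subseteq> A"
  shows "fact (card X) * card {r \<in> preferences A. restrict_pref X r = q} \<le> card (preferences A)"
proof (cases "q \<in> preferences X")
  case True
  let ?F = "{r \<in> preferences A. restrict_pref X r = q}"
  let ?Perm = "{\<pi>. \<pi> permutes X}"
  have fin: "finite X"
    using assms finite_subset by blast
  have inj: "inj_on (\<lambda>(\<pi>, r). rename_pref \<pi> r) (?Perm \<times> ?F)"
  proof (rule inj_onI, clarify)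
    fix \<pi> \<sigma> r r'
    assume \<pi>: "\<pi> permutes X" and \<sigma>: "\<sigma> permutes X"
      and q: "q = restrict_pref X r" and q': "restrict_pref X r' = restrict_pref X r"
      and eq: "rename_pref \<pi> r = rename_pref \<sigma> r'"
    \<comment> \<open>Restricting both sides to \<open>X\<close> replaces \<open>r\<close> and
      \<open>r'\<close> by their common restriction \<open>q\<close>, on which a permutation is
      determined by its effect.\<close>
    have "rename_pref \<pi> q = rename_pref \<sigma> q"
      using eq q q' restrict_rename_pref[OF \<pi>] restrict_rename_pref[OF \<sigma>] by metis
    then have "\<pi> = \<sigma>"
      by (rule rename_pref_permutation_unique[OF fin True \<pi> \<sigma>])
    then show "\<pi> = \<sigma> \<and> r = r'"
      using eq inj_rename_pref[OF permutes_inj[OF \<pi>]] by (simp add: inj_eq)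
  qed
  have "(\<lambda>(\<pi>, r). rename_pref \<pi> r) ` (?Perm \<times> ?F) \<subseteq> preferences A"
    by (auto intro!: rename_pref_in_preferences permutes_subset[OF _ assms(2)])
  from card_inj_on_le[OF inj this finite_preferences[OF assms(1)]] show ?thesis
    by (simp add: card_cartesian_product card_permutations[OF refl fin])
next
  case False
  then have "{r \<in> preferences A. restrict_pref X r = q} = {}"
    using restrict_pref_in_preferences[OF _ assms(2)] by blast
  then show ?thesis
    by (metis card.empty mult_0_right zero_le)
qed

text \<open>By the fibre bound each order of \<open>X\<close> is hit with probability at most
  \<open>1 / fact (card X)\<close>; sum over \<open>S\<close>. Once \<open>card S\<close> is bounded
  by the content, this limits the frequency of \<open>S\<close> under random preferences.\<close>

lemma prob_restrict_pref_le:
  assumes "finite A" "X \<subseteq> A" "finite S"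
  shows "measure_pmf.prob (map_pmf (restrict_pref X) (pmf_of_set (preferences A))) S
    \<le> card S / fact (card X)"
proof -
  note fin = finite_preferences[OF assms(1)]
  have pos: "card (preferences A) > 0"
    using fin preferences_nonempty[of A] by (simp add: card_gt_0_iff)
  have "fact (card X) * card (preferences A \<inter> restrict_pref X -` S)
      = fact (card X) * card (\<Union>q\<in>S. {r \<in> preferences A. restrict_pref X r = q})"
    by (intro arg_cong[of _ _ "\<lambda>T. fact (card X) * card T"]) auto
  also have "\<dots> \<le> (\<Sum>q\<in>S. fact (card X) * card {r \<in> preferences A. restrict_pref X r = q})"
    unfolding sum_distrib_left[symmetric] by (intro mult_left_mono card_UN_le assms) auto
  also have "\<dots> \<le> (\<Sum>q\<in>S. card (preferences A))"
    by (intro sum_mono card_restrict_pref_fibre assms)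
  finally have "fact (card X) * card (preferences A \<inter> restrict_pref X -` S)
      \<le> card S * card (preferences A)"
    by simp
  then have "real (fact (card X) * card (preferences A \<inter> restrict_pref X -` S))
      \<le> real (card S * card (preferences A))"
    by (simp only: of_nat_le_iff)
  then show ?thesis
    using pos by (simp add: measure_pmf_of_set[OF preferences_nonempty fin] field_simps)
qed

text \<open>A supremum in \<open>nat\<close> is only known to dominate the members of a bounded set.
  The bound \<open>2 ^ (card A * card A)\<close> depends on the size alone, so it serves all
  alternative sets of that size. Size 1 is excluded because the content is 1 there by
  convention.\<close>

lemma card_profile_le_content:
  assumes "finite A" "card A \<noteq> 1" "profile I A P" "in_domain I P D"
  shows "real (card (P ` I)) \<le> domain_content D (card A) * fact (card A)"
proof -
  let ?N = "{card (P ` I) | I (A' :: 'a set) P.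
    finite A' \<and> card A' = card A \<and> profile I A' P \<and> in_domain I P D}"
  have "bdd_above ?N"
  proof (rule bdd_aboveI, clarify)
    fix J A' Q
    assume *: "finite (A' :: 'a set)" "card A' = card A" "profile J A' Q"
    have "card (Q ` J) \<le> card (preferences A')"
      by (rule card_mono) (use * finite_preferences in \<open>auto simp: profile_def\<close>)
    also have "\<dots> \<le> 2 ^ (card A * card A)"
      using card_preferences_le[OF *(1)] *(2) by simp
    finally show "card (Q ` J) \<le> 2 ^ (card A * card A)" .
  qed
  moreover have "card (P ` I) \<in> ?N"
    using assms by blast
  ultimately have "card (P ` I) \<le> Sup ?N"
    by (intro cSup_upper)
  then show ?thesis
    using assms(2) by (simp add: domain_content_def)
qed

section \<open>Empirical frequencies\<close>

lemma map_pmf_mem_bernoulli: "map_pmf (\<lambda>x. x \<in> S) Q = bernoulli_pmf (measure_pmf.prob Q S)"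
proof (rule pmf_eqI)
  fix b
  have *: "(\<lambda>x. x \<in> S) -` {True} = S" "(\<lambda>x. x \<in> S) -` {False} = UNIV - S"
    by auto
  show "pmf (map_pmf (\<lambda>x. x \<in> S) Q) b = pmf (bernoulli_pmf (measure_pmf.prob Q S)) b"
    using measure_pmf.prob_compl[of S Q] by (cases b) (simp_all add: pmf_map *)
qed

lemma map_replicate_pmf: "map_pmf (map f) (replicate_pmf n Q) = replicate_pmf n (map_pmf f Q)"
  proof (induction n)
  case (Suc n)
  then have "replicate_pmf n (map_pmf f Q) = bind_pmf (replicate_pmf n Q) (\<lambda>xs. return_pmf (map f xs))"
    by (simp add: map_pmf_def)
  then show ?case
    by (simp add: map_pmf_def bind_assoc_pmf bind_return_pmf)
qed simp

lemma count_replicate_pmf: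
  "map_pmf (\<lambda>xs. length (filter (\<lambda>x. x \<in> S) xs)) (replicate_pmf n Q)
    = binomial_pmf n (measure_pmf.prob Q S)"
  by (simp add: binomial_pmf_altdef map_pmf_mem_bernoulli[symmetric] map_pmf_comp filter_map o_def
      flip: map_replicate_pmf)

text \<open>Independent coordinates model the agents of a random profile, as lists in
  \<open>count_replicate_pmf\<close> model the draws of the oracle.\<close>

lemma count_Pi_pmf:
  "map_pmf (\<lambda>f. card {i \<in> {..<n}. f i \<in> S}) (Pi_pmf {..<n} d (\<lambda>_. Q))
    = binomial_pmf n (measure_pmf.prob Q S)"
proof -
  \<comment> \<open>The default \<open>d \<in> S\<close> of the Boolean product is the image of the
    default \<open>d\<close> under the membership test, as \<open>Pi_pmf_map\<close>
    demands.\<close>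
  have "binomial_pmf n (measure_pmf.prob Q S) = map_pmf (\<lambda>f. card {i \<in> {..<n}. f i})
      (Pi_pmf {..<n} (d \<in> S) (\<lambda>_. map_pmf (\<lambda>x. x \<in> S) Q))"
    by (simp add: binomial_pmf_altdef'[of "{..<n}" _ _ "d \<in> S"] map_pmf_mem_bernoulli)
  also have "\<dots> = map_pmf (\<lambda>f. card {i \<in> {..<n}. f i \<in> S}) (Pi_pmf {..<n} d (\<lambda>_. Q))"
    by (subst Pi_pmf_map[where dflt = d]) (simp_all add: map_pmf_comp)
  finally show ?thesis ..
qed

section \<open>Hoeffding bounds\<close>

text \<open>Hoeffding's inequality \<open>prob_ge'\<close> concerns the exact mean; replacing
  \<open>p\<close> by an upper bound \<open>c\<close> raises the threshold and only shrinks the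
  event.\<close>

lemma binomial_pmf_upper_tail:
  fixes c e :: real and n :: nat
  assumes "p \<in> {0..1}" "p \<le> c" "0 \<le> e" "n > 0"
  shows "measure_pmf.prob (binomial_pmf n p) {k. (c + e) * n \<le> real k} \<le> exp (-2 * real n * e\<^sup>2)"
proof -
  interpret binomial_distribution n p
    using assms(1) by unfold_locales
  have "measure_pmf.prob (binomial_pmf n p) {k. (c + e) * n \<le> real k}
      \<le> measure_pmf.prob (binomial_pmf n p) {k. p + e \<le> real k / n}"
  proof (rule measure_pmf.finite_measure_mono)
    have "p + e \<le> real k / n" if "(c + e) * n \<le> real k" for k
    proof -
      have "p + e \<le> c + e" using assms by simp
      also have "\<dots> \<le> real k / n" using that assms(4) by (simp add: field_simps)
      finally show ?thesis .
    qed
    then show "{k. (c + e) * n \<le> real k} \<subseteq> {k. p + e \<le> real k / n}" by auto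
  qed simp
  also have "\<dots> \<le> exp (-2 * real n * e\<^sup>2)"
    using prob_ge'[OF assms(4,3)] by simp
  finally show ?thesis .
qed

lemma binomial_pmf_lower_tail:
  fixes c e :: real and n :: nat
  assumes "p \<in> {0..1}" "c \<le> p" "0 \<le> e" "n > 0"
  shows "measure_pmf.prob (binomial_pmf n p) {k. real k \<le> (c - e) * n} \<le> exp (-2 * real n * e\<^sup>2)"
proof -
  interpret binomial_distribution n p
    using assms(1) by unfold_locales
  have "measure_pmf.prob (binomial_pmf n p) {k. real k \<le> (c - e) * n}
      \<le> measure_pmf.prob (binomial_pmf n p) {k. real k / n \<le> p - e}"
  proof (rule measure_pmf.finite_measure_mono)
    have "real k / n \<le> p - e" if "real k \<le> (c - e) * n" for k
    proof -
      have "real k / n \<le> c - e" using that assms(4) by (simp add: field_simps)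
      also have "\<dots> \<le> p - e" using assms by simp
      finally show ?thesis .
    qed
    then show "{k. real k \<le> (c - e) * n} \<subseteq> {k. real k / n \<le> p - e}" by auto
  qed simp
  also have "\<dots> \<le> exp (-2 * real n * e\<^sup>2)"
    using prob_le'[OF assms(4,3)] by simp
  finally show ?thesis .
qed

lemma replicate_pmf_upper_tail:
  fixes c e :: real and n :: nat
  assumes "measure_pmf.prob Q S \<le> c" "0 \<le> e" "n > 0"
  shows "measure_pmf.prob (replicate_pmf n Q)
    {xs. (c + e) * n \<le> length (filter (\<lambda>x. x \<in> S) xs)} \<le> exp (-2 * real n * e\<^sup>2)"
  using binomial_pmf_upper_tail[of "measure_pmf.prob Q S" c e n] assms
  by (simp add: count_replicate_pmf[symmetric])

lemma replicate_pmf_lower_tail: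
  fixes c e :: real and n :: nat
  assumes "c \<le> measure_pmf.prob Q S" "0 \<le> e" "n > 0"
  shows "measure_pmf.prob (replicate_pmf n Q)
    {xs. length (filter (\<lambda>x. x \<in> S) xs) \<le> (c - e) * n} \<le> exp (-2 * real n * e\<^sup>2)"
  using binomial_pmf_lower_tail[of "measure_pmf.prob Q S" c e n] assms
  by (simp add: count_replicate_pmf[symmetric])

lemma Pi_pmf_upper_tail:
  fixes c e :: real and n :: nat
  assumes "measure_pmf.prob Q S \<le> c" "0 \<le> e" "n > 0"
  shows "measure_pmf.prob (Pi_pmf {..<n} d (\<lambda>_. Q))
    {f. (c + e) * n \<le> card {i \<in> {..<n}. f i \<in> S}} \<le> exp (-2 * real n * e\<^sup>2)"
  using binomial_pmf_upper_tail[of "measure_pmf.prob Q S" c e n] assms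
  by (simp add: count_Pi_pmf[symmetric, of _ _ _ d])

text \<open>Condition on the first stage: outcomes in \<open>B\<close> contribute at most 1, all
  others at most \<open>e\<close>. Later \<open>B\<close> holds the atypical profiles and
  \<open>F\<close> draws the samples.\<close>

lemma prob_bind_pmf_le:
  assumes "\<And>x. x \<in> set_pmf M \<Longrightarrow> x \<notin> B \<Longrightarrow> measure_pmf.prob (F x) E \<le> e" "0 \<le> e"
  shows "measure_pmf.prob (bind_pmf M F) E \<le> measure_pmf.prob M B + e"
proof -
  have "emeasure (bind_pmf M F) E = (\<integral>\<^sup>+x. emeasure (F x) E \<partial>M)"
    by simp
  also have "\<dots> \<le> (\<integral>\<^sup>+x. indicator B x + ennreal e \<partial>M)"
  proof (rule nn_integral_mono_AE, rule AE_pmfI)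
    fix x assume "x \<in> set_pmf M"
    then show "emeasure (F x) E \<le> indicator B x + ennreal e"
      using assms measure_pmf.emeasure_le_1[of "F x" E]
      by (cases "x \<in> B") (auto simp: measure_pmf.emeasure_eq_measure intro: add_increasing2)
  qed
  also have "\<dots> = ennreal (measure_pmf.prob M B + e)"
    using assms(2) by (simp add: nn_integral_add measure_pmf.emeasure_eq_measure)
  finally show ?thesis
    using assms(2) by (simp add: measure_pmf.emeasure_eq_measure flip: ennreal_plus)
qed

section \<open>Non-adaptive interviews\<close>

text \<open>Continuation style, since an interview returns no value: \<open>R\<close> accumulates
  the pairs answered positively and is passed to \<open>k\<close> on dismissal.\<close>

primrec ask_all :: "('a \<times> 'a) list \<Rightarrow> 'a rel \<Rightarrow> ('a rel \<Rightarrow> 'a strategy) \<Rightarrow> 'a interview" where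
  "ask_all [] R k = Dismiss (k R)"
| "ask_all (p # ps) R k =
     Compare (fst p) (snd p) (\<lambda>b. ask_all ps (if b then insert p R else R) k)"

primrec sample_strategy :: "('a \<times> 'a) list \<Rightarrow> nat \<Rightarrow> ('a rel list \<Rightarrow> bool) \<Rightarrow> 'a strategy" where
  "sample_strategy ps 0 f = Output (f [])"
| "sample_strategy ps (Suc s) f =
     Draw (ask_all ps {} (\<lambda>R. sample_strategy ps s (\<lambda>Rs. f (R # Rs))))"

lemma run_ask_all: "run_interview Q (ask_all ps R k) r = run Q (k (R \<union> r \<inter> set ps))"
proof (induction ps arbitrary: R)
  case (Cons p ps)
  have "(if p \<in> r then insert p R else R) \<union> r \<inter> set ps = R \<union> r \<inter> set (p # ps)"
    by auto
  with Cons show ?case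
    by simp
qed simp

text \<open>Every round draws afresh from \<open>Q\<close>, so the answer relations are independent.
  If \<open>ps\<close> lists all pairs over \<open>X\<close>, then \<open>r \<inter> set ps\<close>
  is the restriction of \<open>r\<close> to \<open>X\<close>.\<close>

lemma run_sample_strategy:
  "run Q (sample_strategy ps s f)
    = map_pmf f (replicate_pmf s (map_pmf (\<lambda>r. r \<inter> set ps) Q))"
proof (induction s arbitrary: f)
  case (Suc s)
  have "run_interview Q (ask_all ps {} (\<lambda>R. sample_strategy ps s (\<lambda>Rs. f (R # Rs))))
      = (\<lambda>r. map_pmf (\<lambda>Rs. f (r \<inter> set ps # Rs))
          (replicate_pmf s (map_pmf (\<lambda>r. r \<inter> set ps) Q)))"
    by (rule ext) (simp add: run_ask_all Suc.IH)
  then show ?case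
    by (simp add: map_pmf_def bind_assoc_pmf bind_return_pmf)
qed simp

section \<open>Number of queries and alternatives used\<close>

lemma queries_ask_all:
  "(\<And>R. queries (k R) = q) \<Longrightarrow> queries_interview (ask_all ps R k) = length ps + q"
  by (induction ps arbitrary: R) simp_all

lemma queries_sample_strategy: "queries (sample_strategy ps s f) = s * length ps"
  by (induction s arbitrary: f) (simp_all add: queries_ask_all)

lemma set_ask_all:
  assumes "set ps \<subseteq> X \<times> X" "\<And>R. set_strategy (k R) \<subseteq> X"
  shows "set_interview (ask_all ps R k) \<subseteq> X"
  using assms(1)
proof (induction ps arbitrary: R)
  case Nil
  then show ?case using assms(2) by simp
next
  case (Cons p ps)
  then show ?case by (auto split: if_splits)
qed

lemma set_sample_strategy:
  "set ps \<subseteq> X \<times> X \<Longrightarrow> set_strategy (sample_strategy ps s f) \<subseteq> X"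
proof (induction s arbitrary: f)
  case (Suc s)
  then show ?case using set_ask_all[OF Suc.prems] by simp
qed simp

section \<open>The tester\<close>

text \<open>The list \<open>xs\<close> is meant to have length \<open>s\<close>, so
  \<open>\<theta>\<close> is a threshold for relative frequencies. The tester takes for
  \<open>\<S>\<close> all sets of orders whose size respects the content bound.\<close>

definition concentrated :: "'b set set \<Rightarrow> real \<Rightarrow> nat \<Rightarrow> 'b list \<Rightarrow> bool" where
  "concentrated \<S> \<theta> s xs \<longleftrightarrow> (\<exists>S\<in>\<S>. \<theta> * s \<le> length (filter (\<lambda>x. x \<in> S) xs))"

section \<open>Concentration of samples from fixed and from random profiles\<close>

lemma prob_concentrated_le:
  assumes "finite \<S>" "\<And>S. S \<in> \<S> \<Longrightarrow> measure_pmf.prob Q S \<le> c" "0 \<le> e" "s > 0"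
  shows "measure_pmf.prob (replicate_pmf s Q) {xs. concentrated \<S> (c + e) s xs}
    \<le> card \<S> * exp (-2 * real s * e\<^sup>2)"
proof -
  let ?E = "\<lambda>S. {xs. (c + e) * s \<le> length (filter (\<lambda>x. x \<in> S) xs)}"
  have "measure_pmf.prob (replicate_pmf s Q) {xs. concentrated \<S> (c + e) s xs}
      = measure_pmf.prob (replicate_pmf s Q) (\<Union>S\<in>\<S>. ?E S)"
    by (intro arg_cong[of _ _ "measure_pmf.prob _"]) (auto simp: concentrated_def)
  also have "\<dots> \<le> (\<Sum>S\<in>\<S>. measure_pmf.prob (replicate_pmf s Q) (?E S))"
    by (rule measure_pmf.finite_measure_subadditive_finite) (use assms(1) in auto)
  also have "\<dots> \<le> (\<Sum>S\<in>\<S>. exp (-2 * real s * e\<^sup>2))"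
    by (intro sum_mono replicate_pmf_upper_tail assms)
  finally show ?thesis
    by simp
qed

lemma prob_map_pmf_of_set_lessThan:
  fixes n :: nat
  assumes "n > 0"
  shows "measure_pmf.prob (map_pmf f (pmf_of_set {..<n})) S = card {i \<in> {..<n}. f i \<in> S} / n"
proof -
  have "{..<n} \<inter> f -` S = {i \<in> {..<n}. f i \<in> S}"
    by auto
  then show ?thesis
    using assms by (simp add: measure_pmf_of_set lessThan_empty_iff)
qed

text \<open>
  The profile and the samples drawn from it contribute one deviation \<open>e\<close> each to the frequency of
  a set \<open>S\<close> of answers.
\<close>

lemma prob_concentrated_random_profile_le:
  assumes "finite \<S>" "\<And>S. S \<in> \<S> \<Longrightarrow> measure_pmf.prob (map_pmf g V) S \<le> c"
    and "0 \<le> e" "s > 0" "n > 0"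
  shows "measure_pmf.prob (bind_pmf (Pi_pmf {..<n} d (\<lambda>_. V))
      (\<lambda>P. replicate_pmf s (map_pmf (g \<circ> P) (pmf_of_set {..<n}))))
      {xs. concentrated \<S> (c + 2 * e) s xs}
    \<le> card \<S> * exp (-2 * real n * e\<^sup>2) + card \<S> * exp (-2 * real s * e\<^sup>2)"
proof -
  let ?U = "Pi_pmf {..<n} d (\<lambda>_. V)"
  let ?E = "\<lambda>S. {P. (c + e) * n \<le> card {i \<in> {..<n}. P i \<in> g -` S}}"
  let ?B = "\<Union>S\<in>\<S>. ?E S"
  have "measure_pmf.prob ?U ?B \<le> (\<Sum>S\<in>\<S>. measure_pmf.prob ?U (?E S))"
    by (rule measure_pmf.finite_measure_subadditive_finite) (use assms(1) in auto)
  also have "\<dots> \<le> (\<Sum>S\<in>\<S>. exp (-2 * real n * e\<^sup>2))"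
    by (intro sum_mono Pi_pmf_upper_tail) (use assms in auto)
  finally have B: "measure_pmf.prob ?U ?B \<le> card \<S> * exp (-2 * real n * e\<^sup>2)"
    by simp
  \<comment> \<open>Outside \<open>?B\<close> all frequencies among the agents are below
    \<open>c + e\<close>. This now serves as the bound on the mean of the samples, which are left
    with the second deviation \<open>e\<close>.\<close>
  have "measure_pmf.prob (replicate_pmf s (map_pmf (g \<circ> P) (pmf_of_set {..<n})))
      {xs. concentrated \<S> (c + 2 * e) s xs} \<le> card \<S> * exp (-2 * real s * e\<^sup>2)"
    if "P \<notin> ?B" for P
  proof -
    have "measure_pmf.prob (map_pmf (g \<circ> P) (pmf_of_set {..<n})) S \<le> c + e" if "S \<in> \<S>" for S
    proof -
      have "card {i \<in> {..<n}. (g \<circ> P) i \<in> S} < (c + e) * n"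
        using \<open>P \<notin> ?B\<close> that by (simp add: not_le)
      then show ?thesis
        using assms(5) by (subst prob_map_pmf_of_set_lessThan) (simp_all add: field_simps)
    qed
    from prob_concentrated_le[OF assms(1) this assms(3,4)] show ?thesis
      by (simp add: algebra_simps)
  qed
  then have "measure_pmf.prob (bind_pmf ?U
      (\<lambda>P. replicate_pmf s (map_pmf (g \<circ> P) (pmf_of_set {..<n}))))
      {xs. concentrated \<S> (c + 2 * e) s xs}
    \<le> measure_pmf.prob ?U ?B + card \<S> * exp (-2 * real s * e\<^sup>2)"
    by (intro prob_bind_pmf_le) simp_all
  with B show ?thesis
    by linarith
qed

text \<open>The gap between the guaranteed frequency \<open>1 - \<epsilon>\<close> and the random
  bound \<open>c\<close> is cut into four pieces \<open>e\<close>, with the threshold in the middle.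
  With few outliers the samples may deviate by \<open>2 * e\<close>; in the random case the profile
  and the samples get \<open>e\<close> each, and each fails with probability at most
  \<open>\<delta> / 2\<close>.\<close>

lemma concentration_tester:
  fixes D :: "'a rel set set" and X :: "'a set" and \<epsilon> :: real
  defines "c \<equiv> domain_content D (card X)"
  defines "e \<equiv> (1 - \<epsilon> - c) / 4"
  defines "\<S> \<equiv> {S. S \<subseteq> preferences X \<and> real (card S) \<le> c * fact (card X)}"
  assumes D: "normal_domain D" and A: "finite A" "X \<subseteq> A" and X: "card X > 1"
    and ps: "set ps = X \<times> X" and e: "e \<ge> 0" and s: "s > 0"
    and tail_s: "card \<S> * exp (-2 * real s * e\<^sup>2) \<le> \<delta> / 2"
    and tail_n: "\<And>n. real n \<ge> n\<^sub>0 \<Longrightarrow> card \<S> * exp (-2 * real n * e\<^sup>2) \<le> \<delta> / 2"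
  shows "outliers_vs_random_tester n\<^sub>0 \<epsilon> \<delta> D A
    (return_pmf (sample_strategy ps s (concentrated \<S> (c + 2 * e) s)))"
proof -
  let ?f = "concentrated \<S> (c + 2 * e) s"
  let ?T = "return_pmf (sample_strategy ps s ?f)"
  have finX: "finite X"
    using A finite_subset by blast
  have fin\<S>: "finite \<S>"
    unfolding \<S>_def by (rule finite_subset[of _ "Pow (preferences X)"])
      (use finite_preferences[OF finX] in auto)
  have restrict: "(\<lambda>r. r \<inter> set ps) = restrict_pref X"
    by (simp add: fun_eq_iff restrict_pref_def ps)
  have exec: "execute ?T n P
      = map_pmf ?f (replicate_pmf s (map_pmf (restrict_pref X \<circ> P) (pmf_of_set {..<n})))" for n P
    by (simp add: execute_def bind_return_pmf run_sample_strategy restrict map_pmf_comp o_def)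
  have "set_strategy t \<subseteq> A" if "t \<in> set_pmf ?T" for t
    using that set_sample_strategy[of ps X] ps A(2) by force
  moreover have "measure_pmf.prob (execute ?T n P) {False} \<le> \<delta>"
    if n: "n \<ge> 1" and P: "profile {..<n} A P" and few: "few_outliers \<epsilon> D n P" for n P
  proof -
    obtain W where W: "W \<subseteq> {..<n}" "(1 - \<epsilon>) * n \<le> card W" "in_domain W P D"
      using few by (auto simp: few_outliers_def)
    \<comment> \<open>The witness for concentration: the restricted preferences of the agents that
      are not outliers.\<close>
    let ?S = "(\<lambda>i. restrict_pref X (P i)) ` W"
    let ?Q = "map_pmf (restrict_pref X \<circ> P) (pmf_of_set {..<n})"
    have PW: "profile W A P"
      using P W(1) finite_subset by (auto simp: profile_def)
    then have RW: "profile W X (\<lambda>i. restrict_pref X (P i))"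
      using restrict_pref_in_preferences[OF _ A(2)] by (auto simp: profile_def)
    have "A \<noteq> {}" "X \<noteq> {}"
      using X A by auto
    then have "in_domain W (\<lambda>i. restrict_pref X (P i)) D"
      using D[unfolded normal_domain_def, rule_format, of A W P X] A PW W(3) by simp
    then have "real (card ?S) \<le> c * fact (card X)"
      using card_profile_le_content[OF finX _ RW] X by (simp add: c_def)
    moreover have "?S \<subseteq> preferences X"
      using RW by (auto simp: profile_def)
    ultimately have S: "?S \<in> \<S>"
      by (simp add: \<S>_def)
    \<comment> \<open>Outliers whose restriction happens to lie in \<open>?S\<close> only raise the
      frequency.\<close>
    have "card W \<le> card {i \<in> {..<n}. (restrict_pref X \<circ> P) i \<in> ?S}"
      by (rule card_mono) (use W(1) in auto)
    then have "(1 - \<epsilon>) * n \<le> card {i \<in> {..<n}. (restrict_pref X \<circ> P) i \<in> ?S}"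
      using W(2) by linarith
    then have "1 - \<epsilon> \<le> measure_pmf.prob ?Q ?S"
      using n by (subst prob_map_pmf_of_set_lessThan) (simp_all add: field_simps)
    note tail = replicate_pmf_lower_tail[OF this, of "2 * e" s]
    have "measure_pmf.prob (execute ?T n P) {False}
        = measure_pmf.prob (replicate_pmf s ?Q) {xs. \<not> ?f xs}"
      by (simp add: exec vimage_def)
    also have "\<dots> \<le> measure_pmf.prob (replicate_pmf s ?Q)
        {xs. length (filter (\<lambda>x. x \<in> ?S) xs) \<le> (1 - \<epsilon> - 2 * e) * s}"
    proof (rule measure_pmf.finite_measure_mono)
      have threshold: "1 - \<epsilon> - 2 * e = c + 2 * e"
        by (simp add: e_def field_simps)
      show "{xs. \<not> ?f xs} \<subseteq>
          {xs. length (filter (\<lambda>x. x \<in> ?S) xs) \<le> (1 - \<epsilon> - 2 * e) * s}"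
        unfolding threshold concentrated_def using S by (auto simp: not_le intro: less_imp_le)
    qed simp
    also have "\<dots> \<le> exp (-2 * real s * (2 * e)\<^sup>2)"
      using tail e s by simp
    \<comment> \<open>The exponent and the factor 1 are weakened to match \<open>tail_s\<close>;
      \<open>\<S>\<close> is nonempty because it contains \<open>?S\<close>.\<close>
    also have "\<dots> \<le> 1 * exp (-2 * real s * e\<^sup>2)"
      by (simp add: power_mult_distrib)
    also have "\<dots> \<le> card \<S> * exp (-2 * real s * e\<^sup>2)"
    proof (rule mult_right_mono)
      have "card \<S> > 0"
        using S fin\<S> by (auto simp: card_gt_0_iff)
      then show "1 \<le> real (card \<S>)"
        by simp
    qed simp
    also have "\<dots> \<le> \<delta>"
    proof -
      have "0 \<le> card \<S> * exp (-2 * real s * e\<^sup>2)"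
        by simp
      then show ?thesis
        using tail_s by linarith
    qed
    finally show ?thesis .
  qed
  moreover have "measure_pmf.prob (bind_pmf (uniform_profile n A) (execute ?T n)) {True} \<le> \<delta>"
    if n: "n \<ge> 1" "real n \<ge> n\<^sub>0" for n
  proof -
    have mass: "measure_pmf.prob (map_pmf (restrict_pref X) (pmf_of_set (preferences A))) S \<le> c"
      if "S \<in> \<S>" for S
    proof -
      have "finite S"
        using that finite_preferences[OF finX] finite_subset by (auto simp: \<S>_def)
      note prob_restrict_pref_le[OF A this]
      also have "card S / fact (card X) \<le> c"
        using that by (simp add: \<S>_def field_simps)
      finally show ?thesis .
    qed
    have "bind_pmf (uniform_profile n A) (execute ?T n)
        = map_pmf ?f (bind_pmf (Pi_pmf {..<n} {} (\<lambda>_. pmf_of_set (preferences A)))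
            (\<lambda>P. replicate_pmf s (map_pmf (restrict_pref X \<circ> P) (pmf_of_set {..<n}))))"
      unfolding exec[abs_def] uniform_profile_def map_bind_pmf ..
    then have "measure_pmf.prob (bind_pmf (uniform_profile n A) (execute ?T n)) {True}
        = measure_pmf.prob (bind_pmf (Pi_pmf {..<n} {} (\<lambda>_. pmf_of_set (preferences A)))
            (\<lambda>P. replicate_pmf s (map_pmf (restrict_pref X \<circ> P) (pmf_of_set {..<n}))))
          {xs. ?f xs}"
      by (simp add: vimage_def)
    also have "\<dots> \<le> card \<S> * exp (-2 * real n * e\<^sup>2) + card \<S> * exp (-2 * real s * e\<^sup>2)"
      by (rule prob_concentrated_random_profile_le[OF fin\<S> mass e s]) (use n in auto)
    also have "\<dots> \<le> \<delta>"
      using tail_s tail_n[OF n(2)] by linarith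
    finally show ?thesis .
  qed
  ultimately show ?thesis
    unfolding outliers_vs_random_tester_def by simp
qed

text \<open>\<open>K\<close> and \<open>C\<close> are fixed before the domain, so they depend on
  \<open>m\<^sub>0\<close> only. \<open>K * b\<close> is a lower bound both for the agents of a
  random profile and for the samples drawn, as both are controlled with the same deviation;
  \<open>C * b\<close> bounds the queries.\<close>

theorem corollary3p5:
  fixes m\<^sub>0 :: nat
  shows "\<exists>(K::real)>0. \<exists>(C::real)>0. \<forall>(D :: ('a :: infinite) rel set set) A \<epsilon>\<^sub>v \<delta> :: real.
    is_domain D \<and> normal_domain D \<and> neutral D \<and>
    (\<exists>m\<ge>1. domain_content D m < 1) \<and> m\<^sub>0 = critical_size D \<and>
    finite A \<and> card A \<ge> m\<^sub>0 \<and>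
    0 \<le> \<epsilon>\<^sub>v \<and> \<epsilon>\<^sub>v < domain_residue D m\<^sub>0 \<and> 0 < \<delta> \<and> \<delta> < 1/2 \<longrightarrow>
    (let b = 1 / (1 - \<epsilon>\<^sub>v / domain_residue D m\<^sub>0)\<^sup>2 * ln (1 / \<delta>) in
      \<exists>T. outliers_vs_random_tester (K * b) \<epsilon>\<^sub>v \<delta> D A T \<and> sample_complexity_le T (C * b))"
proof -
  \<comment> \<open>The union bound costs \<open>2 ^ M\<close>, and the residue is at least \<open>1 / m\<^sub>0!\<close> as a positive multiple of it.\<close>
  define M :: nat where "M = 2 ^ (m\<^sub>0 * m\<^sub>0)"
  define K :: real where "K = 8 * (fact m\<^sub>0)\<^sup>2 * (real M + 2)"
  \<comment> \<open>Each agent answers \<open>m\<^sub>0 * m\<^sub>0\<close> queries, and at most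
    \<open>K * b + 1 \<le> (K + 2) * b\<close> agents are drawn because
    \<open>1 / 2 \<le> b\<close>. The final \<open>1\<close> keeps \<open>C\<close> positive even
    for \<open>m\<^sub>0 = 0\<close>.\<close>
  define C :: real where "C = (K + 2) * (real m\<^sub>0 * real m\<^sub>0 + 1)"
  have K: "K > 0"
    unfolding K_def by (intro mult_pos_pos) (simp_all add: add_nonneg_pos)
  then have C: "C > 0"
    unfolding C_def by (intro mult_pos_pos) (simp_all add: add_nonneg_pos)
  have "\<exists>T. outliers_vs_random_tester (K * b) \<epsilon> \<delta> D A T \<and> sample_complexity_le T (C * b)"
    if D: "normal_domain D" and ex: "\<exists>m\<ge>1. domain_content D m < 1" and m\<^sub>0: "m\<^sub>0 = critical_size D"
      and A: "finite A" "card A \<ge> m\<^sub>0" and \<epsilon>: "0 \<le> \<epsilon>" "\<epsilon> < domain_residue D m\<^sub>0"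
      and \<delta>: "0 < \<delta>" "\<delta> < 1/2"
      and b: "b = 1 / (1 - \<epsilon> / domain_residue D m\<^sub>0)\<^sup>2 * ln (1 / \<delta>)"
    for D :: "'a rel set set" and A \<epsilon> \<delta> b
  proof -
    define c where "c = domain_content D m\<^sub>0"
    define \<rho> where "\<rho> = domain_residue D m\<^sub>0"
    define e where "e = (1 - \<epsilon> - c) / 4"
    have "m\<^sub>0 \<ge> 1 \<and> domain_content D m\<^sub>0 < 1"
      unfolding m\<^sub>0 critical_size_def using ex by (rule LeastI_ex)
    \<comment> \<open>Size 1 cannot be critical, as the content is 1 there.\<close>
    then have c1: "c < 1" and m1: "m\<^sub>0 > 1"
      by (auto simp: c_def domain_content_def split: if_splits)
    have \<rho>: "\<rho> = 1 - c"
      by (simp add: \<rho>_def c_def domain_residue_def)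
    have "\<rho> \<ge> 1 / fact m\<^sub>0"
    proof -
      obtain k where k: "c = real k / fact m\<^sub>0"
        using m1 by (auto simp: c_def domain_content_def)
      have "real k < real (fact m\<^sub>0)"
        using c1 unfolding k by (simp add: field_simps)
      then have "k < fact m\<^sub>0"
        by (simp only: of_nat_less_iff)
      then have "real (k + 1) \<le> real (fact m\<^sub>0)"
        unfolding of_nat_le_iff by simp
      then show ?thesis
        unfolding \<rho> k by (simp add: field_simps)
    qed
    then have \<rho>0: "\<rho> > 0" and \<rho>_inv: "1 \<le> fact m\<^sub>0 * \<rho>"
      by (auto simp: field_simps intro: less_le_trans[of 0 "1 / fact m\<^sub>0"])
    define \<gamma> where "\<gamma> = 1 - \<epsilon> / \<rho>"
    have \<gamma>: "0 < \<gamma>" "\<gamma> \<le> 1"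
      using \<epsilon> \<rho>0 by (auto simp: \<gamma>_def \<rho>_def)
    \<comment> \<open>\<open>4 * e\<close> is \<open>\<rho> - \<epsilon>\<close>; factoring out
      \<open>\<rho>\<close> exposes the \<open>\<gamma>\<close> whose square appears in
      \<open>b\<close>.\<close>
    have e_eq: "4 * e = \<rho> * \<gamma>"
      using \<rho>0 by (simp add: e_def \<gamma>_def \<rho> field_simps)
    then have e0: "e > 0"
      using \<gamma>(1) \<rho>0 by (smt (verit) mult_pos_pos)
    define l where "l = ln (1 / \<delta>)"
    \<comment> \<open>This lets \<open>ln 2\<close> terms be absorbed into multiples of
      \<open>l\<close>.\<close>
    have l: "ln 2 \<le> l"
      using \<delta> by (simp add: l_def field_simps)
    have l2: "1 / 2 \<le> l"
      using l ln2_ge_two_thirds by linarith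
    have b_eq: "b = l / \<gamma>\<^sup>2"
      by (simp add: b l_def \<gamma>_def \<rho>_def)
    have "l / 1 \<le> l / \<gamma>\<^sup>2"
      using \<gamma> l2 by (intro divide_left_mono) (simp_all add: power_le_one)
    then have b2: "1 / 2 \<le> b"
      using l2 unfolding b_eq by linarith
    \<comment> \<open>\<open>2 * e\<^sup>2\<close> is
      \<open>(\<rho> * \<gamma>)\<^sup>2 / 8\<close>. In \<open>K * b\<close> the 8 and
      \<open>\<gamma>\<^sup>2\<close> cancel, and \<open>(fact m\<^sub>0)\<^sup>2\<close> outweighs
      \<open>\<rho>\<^sup>2\<close>.\<close>
    have Kb: "(real M + 2) * l \<le> 2 * (K * b) * e\<^sup>2"
    proof -
      have "1 \<le> (fact m\<^sub>0 * \<rho>)\<^sup>2"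
        using \<rho>_inv by (simp add: one_le_power)
      then have "1 * ((real M + 2) * l) \<le> (fact m\<^sub>0 * \<rho>)\<^sup>2 * ((real M + 2) * l)"
        using l2 by (intro mult_right_mono) auto
      also have "\<dots> = 2 * (K * b) * ((\<rho> * \<gamma>) / 4)\<^sup>2"
        using \<gamma>(1) by (simp add: K_def b_eq power2_eq_square field_simps)
      also have "(\<rho> * \<gamma>) / 4 = e"
        using e_eq by simp
      finally show ?thesis
        by simp
    qed
    obtain X where X: "X \<subseteq> A" "card X = m\<^sub>0" "finite X"
      using obtain_subset_with_card_n[OF A(2)] by blast
    obtain ps where ps: "set ps = X \<times> X" "distinct ps"
      using finite_distinct_list[of "X \<times> X"] X(3) by auto
    have len: "length ps = m\<^sub>0 * m\<^sub>0"
      using distinct_card[OF ps(2)] ps(1) X by (simp add: card_cartesian_product)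
    define \<S> where "\<S> = {S. S \<subseteq> preferences X \<and> real (card S) \<le> c * fact (card X)}"
    have card\<S>: "card \<S> \<le> 2 ^ M"
    proof -
      have "card \<S> \<le> card (Pow (preferences X))"
        by (rule card_mono) (use finite_preferences[OF X(3)] in \<open>auto simp: \<S>_def\<close>)
      also have "\<dots> = 2 ^ card (preferences X)"
        by (rule card_Pow[OF finite_preferences[OF X(3)]])
      also have "\<dots> \<le> 2 ^ M"
        using card_preferences_le[OF X(3)] X(2) by (intro power_increasing) (simp_all add: M_def)
      finally show ?thesis .
    qed
    have tail: "card \<S> * exp (-2 * real n * e\<^sup>2) \<le> \<delta> / 2" if "real n \<ge> K * b" for n
    proof -
      have "(real M + 2) * l \<le> 2 * real n * e\<^sup>2"
        using Kb that by (smt (verit) mult_right_mono zero_le_power2)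
      \<comment> \<open>The exponent pays \<open>real M * ln 2\<close> for the at most
        \<open>2 ^ M\<close> sets, \<open>ln 2\<close> for halving \<open>\<delta>\<close>, and
        \<open>l\<close> for \<open>\<delta>\<close> itself.\<close>
      moreover have "real M * ln 2 + ln 2 + l \<le> (real M + 2) * l"
        using l mult_left_mono[OF l, of "real M"] by (simp add: algebra_simps)
      ultimately have "exp (-2 * real n * e\<^sup>2) \<le> exp (- (real M * ln 2) - ln 2 - l)"
        by simp
      also have "\<dots> = \<delta> / (2 * 2 ^ M)"
        using \<delta>(1) by (simp add: exp_add exp_diff exp_minus exp_of_nat_mult l_def ln_div field_simps)
      finally have "card \<S> * exp (-2 * real n * e\<^sup>2) \<le> 2 ^ M * (\<delta> / (2 * 2 ^ M))"
        using card\<S> \<delta>(1) by (intro mult_mono) (simp_all flip: of_nat_le_iff)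
      then show ?thesis
        by simp
    qed
    \<comment> \<open>Rounding up \<open>K * b\<close> makes \<open>tail\<close> apply to the number
      of samples as well.\<close>
    define s where "s = nat \<lceil>K * b\<rceil>"
    have Kb0: "K * b > 0"
      using K b2 by (intro mult_pos_pos) auto
    then have s: "s > 0" "K * b \<le> s" "s \<le> K * b + 1"
      unfolding s_def by linarith+
    let ?T = "return_pmf (sample_strategy ps s (concentrated \<S> (c + 2 * e) s))"
    have "outliers_vs_random_tester (K * b) \<epsilon> \<delta> D A ?T"
      unfolding \<S>_def e_def c_def X(2)[symmetric]
      by (rule concentration_tester[OF D A(1) X(1) _ ps(1) _ s(1)])
        (use e0 m1 X(2) tail tail[OF s(2)] in \<open>simp_all add: e_def c_def \<S>_def\<close>)
    moreover have "sample_complexity_le ?T (C * b)"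
    proof -
      have "real s * (real m\<^sub>0 * real m\<^sub>0) \<le> ((K + 2) * b) * (real m\<^sub>0 * real m\<^sub>0 + 1)"
        using s(3) b2 Kb0 by (intro mult_mono) (auto simp: algebra_simps)
      then show ?thesis
        by (simp add: sample_complexity_le_def queries_sample_strategy len C_def algebra_simps)
    qed
    ultimately show ?thesis
      by blast
  qed
  then show ?thesis
    using K C unfolding Let_def by blast
qed

end
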